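(* Let $r\ge 2$ be an integer and put $m=3\cdot 2^r$. For every $n\ge 0$, \[ \nu_2(t_m(n))=\nu_2\binom{n+m-1}{m-1}. \]
   Context: Let $T(x)=\prod_{j\ge 0}(1-x^{2^j})\in\mathbb Z[[x]]$ be the Thue--Morse generating function, and for each integer $m\ge 1$ define the integers $t_m(n)$ by $T(x)^m=\sum_{n\ge 0}t_m(n)x^n$. For a nonzero integer $a$, $\nu_2(a)$ is the largest integer $v$ such that $2^v$ divides $a$, and $\nu_2(0)=+\infty$. *)

theory Defs
  imports
    "HOL-Analysis.Infinite_Products"
    "HOL-Computational_Algebra.Formal_Power_Series"
    "HOL-Computational_Algebra.Primes"
    "HOL-Library.Extended_Nat"
begin

text \<open>
  The infinite product is taken in \<^typ>\<open>int fps\<close> with respect to its \<open>X\<close>-adic metric.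
\<close>

definition thue_morse_fps :: "int fps" where
  "thue_morse_fps = (\<Prod>j. 1 - fps_X ^ (2 ^ j))"

definition thue_morse_coeff :: "nat \<Rightarrow> nat \<Rightarrow> int" where
  "thue_morse_coeff m n = fps_nth (thue_morse_fps ^ m) n"

text \<open>
  \<^const>\<open>multiplicity\<close> returns \<open>0\<close> at \<open>0\<close>, hence the separate case.
\<close>

definition nu2 :: "int \<Rightarrow> enat" where
  "nu2 a = (if a = 0 then \<infinity> else enat (multiplicity 2 a))"

text \<open>
  \<^const>\<open>prodinf\<close> is defined by a definite description, so its value is meaningful only if
  the product converges, which is shown here.
\<close>

lemma thue_morse_has_prod:
  "(\<lambda>j. 1 - fps_X ^ (2 ^ j)) has_prod thue_morse_fps"
proof -
  define P :: "nat \<Rightarrow> int fps" where "P = (\<lambda>n. \<Prod>i\<le>n. 1 - fps_X ^ (2 ^ i))"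
  define L :: "int fps" where "L = Abs_fps (\<lambda>k. fps_nth (P k) k)"
  have step: "fps_nth (P (Suc n)) k = fps_nth (P n) k" if "k \<le> n" for n k
  proof -
    have "n < 2 ^ n"
      by simp
    then have "k < 2 ^ Suc n"
      using that unfolding power_Suc by linarith
    then show ?thesis
      by (simp add: P_def right_diff_distrib fps_X_power_mult_right_nth del: power_Suc)
  qed
  have stable: "fps_nth (P n) k = fps_nth L k" if "k \<le> n" for n k
    using that by (induction n rule: dec_induct) (simp_all add: L_def step)
  have "P \<longlonglongrightarrow> L"
    unfolding tendsto_fps_iff
    by (intro allI eventually_sequentiallyI) (use stable in blast)
  moreover have "fps_nth L 0 = 1"
    by (simp add: L_def P_def)
  then have "L \<noteq> 0"
    by auto
  ultimately have "raw_has_prod (\<lambda>j. 1 - fps_X ^ (2 ^ j)) 0 L"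
    by (simp add: raw_has_prod_def P_def)
  then have "(\<lambda>j. 1 - fps_X ^ (2 ^ j)) has_prod L"
    by (simp add: has_prod_def)
  then show ?thesis
    using has_prod_unique unfolding thue_morse_fps_def by metis
qed

end

theory Submission
  imports Defs
begin

text \<open>
  Put \<open>z = x / (1 - x)\<^sup>2\<close>. The series \<open>E = ((1 - x) T(x))\<^sup>2\<close> satisfies \<open>E(x) = E(x\<^sup>2) / (1 + 4 z)\<close>, and
  \<open>z(x\<^sup>2) = z\<^sup>2 / (1 + 4 z)\<close>, so \<open>E\<close> is a power series in \<open>z\<close>. Let \<open>s\<close> be the binary digit sum. Because
  \<open>s\<close> is subadditive, the power series in \<open>z\<close> whose \<open>i\<close>-th coefficient is divisible by
  \<open>4 ^ s(i)\<close> form a ring, and this ring contains \<open>E\<close>. As \<open>T\<^sup>m = (1 - x) ^ (-m) E ^ (m / 2)\<close>, it follows that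
  \<open>t\<^sub>m(n) = (\<Sum>i\<le>n. b\<^sub>i ((n + m + i - 1) choose (m + 2 i - 1)))\<close> with \<open>b\<^sub>0 = 1\<close> and
  \<open>2 ^ (r - 1) 4 ^ s(i)\<close> dividing \<open>b\<^sub>i\<close> for \<open>i > 0\<close>. The term with \<open>i = 0\<close> is the binomial coefficient
  of the theorem, and by Kummer's theorem every other term has a strictly larger 2-adic valuation.
\<close>

subsection \<open>Binary digit sums and binomial coefficients\<close>

text \<open>The defining equation has an unguarded left-hand side, so it is taken out of the simpset
  below to keep it from unfolding forever.\<close>

fun digsum :: "nat \<Rightarrow> nat" where
  "digsum n = (if n = 0 then 0 else n mod 2 + digsum (n div 2))"

declare digsum.simps [simp del]

lemma digsum_0 [simp]: "digsum 0 = 0"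
  by (simp add: digsum.simps)

lemma digsum_double [simp]: "digsum (2 * n) = digsum n"
  by (cases "n = 0") (simp_all add: digsum.simps [of "2 * n"])

lemma digsum_Suc_double [simp]: "digsum (Suc (2 * n)) = Suc (digsum n)"
  by (simp add: digsum.simps [of "Suc (2 * n)"])

lemma digsum_pos: "n > 0 \<Longrightarrow> digsum n > 0"
proof (induction n rule: less_induct)
  case (less n)
  then show ?case
    by (cases n rule: parity_cases) (auto elim!: evenE oddE)
qed

lemma digsum_eq_1_imp_power2: "digsum n = 1 \<Longrightarrow> \<exists>k. n = 2 ^ k"
proof (induction n rule: less_induct)
  case (less n)
  show ?case
  proof (cases "even n")
    case True
    then obtain h where h: "n = 2 * h" by (elim evenE)
    with less.prems have "h < n" "digsum h = 1" by (auto intro: ccontr)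
    then obtain k where "h = 2 ^ k" using less.IH by blast
    then have "n = 2 ^ Suc k" using h by simp
    then show ?thesis by blast
  next
    case False
    then obtain h where h: "n = Suc (2 * h)" by (auto elim: oddE)
    with less.prems digsum_pos[of h] have "h = 0" by (cases "h = 0") auto
    then have "n = 2 ^ 0" using h by simp
    then show ?thesis by blast
  qed
qed

text \<open>Adding 1 clears the trailing ones of \<open>n\<close>, whose number is the valuation of
  \<open>Suc n\<close>, and sets the zero above them.\<close>

lemma multiplicity_Suc_digsum: "multiplicity 2 (Suc n) + digsum (Suc n) = Suc (digsum n)"
proof (induction n rule: less_induct)
  case (less n)
  show ?case
  proof (cases "even n")
    case True
    then obtain h where h: "n = 2 * h" by (elim evenE)
    have "multiplicity 2 (Suc n) = 0"
      using True by (intro not_dvd_imp_multiplicity_0) simp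
    then show ?thesis using h by simp
  next
    case False
    then obtain h where h: "n = Suc (2 * h)" by (auto elim: oddE)
    have "multiplicity 2 (2 * Suc h) = Suc (multiplicity 2 (Suc h))"
      by (rule multiplicity_times_same) auto
    moreover have "digsum (2 * Suc h) = digsum (Suc h)" by (rule digsum_double)
    moreover have "Suc n = 2 * Suc h" using h by simp
    ultimately show ?thesis using h less.IH[of h] by simp
  qed
qed

text \<open>Legendre's formula for the prime 2: the preceding identity telescopes over the factors
  of the factorial.\<close>

lemma multiplicity_fact_digsum: "multiplicity 2 (fact n :: nat) + digsum n = n"
proof (induction n)
  case (Suc n)
  have "multiplicity 2 (fact (Suc n) :: nat) = multiplicity 2 (Suc n) + multiplicity 2 (fact n :: nat)"
    unfolding fact_Suc of_nat_id by (rule prime_elem_multiplicity_mult_distrib) auto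
  then show ?case using Suc multiplicity_Suc_digsum[of n] by simp
qed simp

text \<open>Kummer's theorem for the prime 2, obtained from Legendre's formula and stated additively
  to avoid truncated subtraction.\<close>

lemma multiplicity_binomial_digsum:
  "multiplicity 2 ((a + b) choose a) + digsum (a + b) = digsum a + digsum b"
proof -
  have "multiplicity 2 (fact (a + b) :: nat)
      = multiplicity 2 (fact a * fact b * ((a + b) choose a) :: nat)"
    using binomial_fact_lemma[of a "a + b"] by simp
  also have "\<dots> = multiplicity 2 (fact a :: nat) + multiplicity 2 (fact b :: nat)
      + multiplicity 2 ((a + b) choose a)"
    by (simp add: prime_elem_multiplicity_mult_distrib)
  finally show ?thesis
    using multiplicity_fact_digsum[of a] multiplicity_fact_digsum[of b]
      multiplicity_fact_digsum[of "a + b"] by linarith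
qed

lemma digsum_add_le: "digsum (a + b) \<le> digsum a + digsum b"
  using multiplicity_binomial_digsum[of a b] by linarith

text \<open>Two odd summands produce a carry at the lowest digit, and every carry lowers the digit
  sum by one.\<close>

lemma digsum_odd_add_odd_less:
  assumes "odd a" "odd b"
  shows "digsum (a + b) < digsum a + digsum b"
proof -
  obtain c d where cd: "a = Suc (2 * c)" "b = Suc (2 * d)"
    using assms by (auto elim!: oddE)
  have "digsum (a + b) = digsum (2 * (c + d + 1))" using cd by (simp add: algebra_simps)
  also have "\<dots> \<le> digsum c + digsum d + 1"
    using digsum_add_le[of "c + d" 1] digsum_add_le[of c d] digsum_Suc_double[of 0]
    by (simp only: digsum_double)  simp
  finally show ?thesis using cd by simp
qed

lemma digsum_le_self: "digsum n \<le> n"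
  using multiplicity_fact_digsum[of n] by linarith

text \<open>
  With \<open>i = 2 ^ e * c\<close>, the lowest nonzero digit of \<open>i\<close> produces a carry in \<open>n = (n - i) + i\<close> or in \<open>(n + m) + i\<close>,
  according to the digit of \<open>n\<close> at the same place.
\<close>

lemma digsum_carry:
  assumes "odd c" "2 ^ e * c \<le> n" "2 ^ Suc e dvd m"
  shows "digsum n + digsum (n + m + 2 ^ e * c)
    < digsum (n - 2 ^ e * c) + digsum (n + m) + 2 * digsum (2 ^ e * c)"
  using assms(2,3)
proof (induction e arbitrary: n m)
  case 0
  have 1: "digsum (n - c + c) \<le> digsum (n - c) + digsum c"
    and 2: "digsum (n + m + c) \<le> digsum (n + m) + digsum c"
    by (rule digsum_add_le)+
  have "digsum (n - c + c) < digsum (n - c) + digsum c \<or>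
      digsum (n + m + c) < digsum (n + m) + digsum c"
  proof (cases "even n")
    case True
    then have "odd (n - c)" using assms(1) 0 by simp
    then show ?thesis using digsum_odd_add_odd_less assms(1) by blast
  next
    case False
    then have "odd (n + m)" using 0 by simp
    then show ?thesis using digsum_odd_add_odd_less assms(1) by blast
  qed
  then show ?case using 1 2 0 by auto
next
  case (Suc e)
  obtain m' where m': "m = 2 * m'" "2 ^ Suc e dvd m'"
    using Suc.prems(2) by (auto elim!: dvdE)
  define n' where "n' = n div 2"
  define i where "i = 2 ^ e * c"
  have i: "2 ^ Suc e * c = 2 * i" by (simp add: i_def)
  have le: "i \<le> n'" using Suc.prems(1) unfolding i n'_def by simp
  have IH: "digsum n' + digsum (n' + m' + i) < digsum (n' - i) + digsum (n' + m') + 2 * digsum i"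
    using Suc.IH[of n' m'] le m'(2) unfolding i_def by simp
  show ?case
  \<comment> \<open>Since \<open>m\<close> and \<open>2 * i\<close> are even, all four numbers built
    from \<open>n\<close> have the same last digit. It counts twice on each side, so it can be
    removed.\<close>
  proof (cases "even n")
    case True
    then have n: "n = 2 * n'" by (simp add: n'_def)
    have "n - 2 * i = 2 * (n' - i)" "n + m = 2 * (n' + m')" "n + m + 2 * i = 2 * (n' + m' + i)"
      using n m' by simp_all
    then show ?thesis unfolding i using IH n by (simp only: digsum_double)
  next
    case False
    then have n: "n = Suc (2 * n')" by (simp add: n'_def)
    have "n - 2 * i = Suc (2 * (n' - i))" "n + m = Suc (2 * (n' + m'))"
      "n + m + 2 * i = Suc (2 * (n' + m' + i))"
      using n m' le by simp_all
    then show ?thesis unfolding i using IH n by (simp only: digsum_double digsum_Suc_double)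
  qed
qed

section \<open>Valuation inequality between the binomial coefficients\<close>

text \<open>This is \<open>multiplicity_binomial_le\<close> after Kummer's theorem; \<open>r\<close>
  cancels because \<open>m - 1\<close> has digit sum \<open>r + 1\<close>. Two uses of subadditivity
  leave only the 3 to be covered by the digit sum of \<open>m + 2 * i - 1\<close>.\<close>

lemma digsum_inequality:
  assumes r: "r \<ge> 2" and m: "m = 3 * 2 ^ r" and i: "1 \<le> i" "i \<le> n"
  shows "digsum n + digsum (n + m + i - 1) + 3
    \<le> digsum (m + 2 * i - 1) + digsum (n - i) + digsum (n + m - 1) + 2 * digsum i"
proof -
  define x where "x = 3 * 2 ^ (r - 1) + (i - 1)"
  have r1: "(2::nat) ^ r = 2 * 2 ^ (r - 1)" using r by (cases r) auto
  have "m + 2 * i - 1 = Suc (2 * x)" using m i r1 by (simp add: x_def)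
  then have x: "digsum (m + 2 * i - 1) = Suc (digsum x)" by simp
  have "x > 0" by (simp add: x_def)
  then have xpos: "digsum x > 0" by (rule digsum_pos)
  have m1: "m \<ge> 1" using m by simp
  have 1: "digsum n \<le> digsum (n - i) + digsum i"
    using digsum_add_le[of "n - i" i] i by simp
  have 2: "digsum (n + m + i - 1) \<le> digsum (n + m - 1) + digsum i"
    using digsum_add_le[of "n + m - 1" i] m1 by simp
  show ?thesis
  proof (cases "digsum x = 1")
    case False
    then show ?thesis using 1 2 x xpos by linarith
  next
    \<comment> \<open>Subadditivity alone falls short by one here; the missing unit comes from a carry.\<close>
    case True
    then obtain k where k: "x = 2 ^ k" using digsum_eq_1_imp_power2 by blast
    have "2 ^ r < x" using r1 unfolding x_def by (simp add: add_strict_increasing)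
    then have "r < k" unfolding k by (simp add: power_strict_increasing_iff)
    \<comment> \<open>From \<open>x = 2 ^ k\<close> follows
      \<open>i - 1 = 2 ^ k - 3 * 2 ^ (r - 1)\<close>, and \<open>c\<close> is its odd part. Since
      \<open>r \<ge> 2\<close>, the index \<open>i\<close> itself is odd.\<close>
    define c :: nat where "c = 2 ^ (k - (r - 1)) - 3"
    have k2: "k - (r - 1) \<ge> 2" using \<open>r < k\<close> r by linarith
    then have four: "(2::nat) ^ 2 \<le> 2 ^ (k - (r - 1))" by (rule power_increasing) simp
    have c: "odd c" using four k2 by (simp add: c_def)
    have "(2::nat) ^ k = 2 ^ (r - 1) * 2 ^ (k - (r - 1))"
      using \<open>r < k\<close> by (simp flip: power_add)
    moreover have "2 ^ (r - 1) * c = 2 ^ (r - 1) * 2 ^ (k - (r - 1)) - 3 * 2 ^ (r - 1)"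
      by (simp add: c_def diff_mult_distrib2 mult.commute)
    ultimately have "i - 1 = 2 ^ (r - 1) * c"
      using k unfolding x_def by linarith
    then have ii: "i = Suc (2 * (2 ^ (r - 2) * c))"
      using i r by (cases r; cases "r - 1") auto
    define j where "j = 2 ^ (r - 2) * c"
    have ij: "i = Suc (2 * j)" using ii by (simp add: j_def)
    have strict: "digsum n + digsum (n + m + i - 1) <
        digsum (n - i) + digsum (n + m - 1) + 2 * digsum i"
    proof (cases "even n")
      case True
      then have "odd (n - i)" using ij i by simp
      then have "digsum (n - i + i) < digsum (n - i) + digsum i"
        using digsum_odd_add_odd_less[of "n - i" i] ij by simp
      then show ?thesis using 2 i by simp
    next
      \<comment> \<open>The lowest digit gives no carry in \<open>(n - i) + i\<close> here, so it is
        stripped, and \<open>digsum_carry\<close> is applied to the halves \<open>h\<close>,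
        \<open>j\<close> and \<open>m / 2\<close>.\<close>
      case False
      then obtain h where h: "n = Suc (2 * h)" by (auto elim: oddE)
      have mm: "m = 2 * (3 * 2 ^ (r - 1))" using m r1 by simp
      have "Suc (r - 2) = r - 1" using r by linarith
      then have "2 ^ Suc (r - 2) dvd 3 * (2::nat) ^ (r - 1)" by (simp only: dvd_triv_right)
      moreover have "j \<le> h" using i ij h by simp
      ultimately have *: "digsum h + digsum (h + 3 * 2 ^ (r - 1) + j)
          < digsum (h - j) + digsum (h + 3 * 2 ^ (r - 1)) + 2 * digsum j"
        using digsum_carry[OF c, of "r - 2" h "3 * 2 ^ (r - 1)"] by (simp add: j_def)
      have "n - i = 2 * (h - j)" "n + m - 1 = 2 * (h + 3 * 2 ^ (r - 1))"
        "n + m + i - 1 = Suc (2 * (h + 3 * 2 ^ (r - 1) + j))"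
        using h ij mm by simp_all
      then have "digsum (n - i) = digsum (h - j)" "digsum n = Suc (digsum h)" "digsum i = Suc (digsum j)"
        "digsum (n + m - 1) = digsum (h + 3 * 2 ^ (r - 1))"
        "digsum (n + m + i - 1) = Suc (digsum (h + 3 * 2 ^ (r - 1) + j))"
        unfolding h ij by (simp_all only: digsum_double digsum_Suc_double)
      then show ?thesis using * by presburger
    qed
    then show ?thesis using x True by linarith
  qed
qed

lemma multiplicity_binomial_le:
  assumes r: "r \<ge> 2" and m: "m = 3 * 2 ^ r" and i: "1 \<le> i" "i \<le> n"
  shows "multiplicity 2 ((n + m - 1) choose (m - 1)) + 2
    \<le> multiplicity 2 ((n + m + i - 1) choose (m + 2 * i - 1)) + r + 2 * digsum i"
proof -
  have m1: "m \<ge> 1" using m by simp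
  \<comment> \<open>In binary this number is 10 followed by \<open>k\<close> ones.\<close>
  have "digsum (3 * 2 ^ k - 1) = Suc k" for k
  proof (induction k)
    case 0
    show ?case using digsum_double[of 1] digsum_Suc_double[of 0] by simp
  next
    case (Suc k)
    have "3 * 2 ^ Suc k - 1 = Suc (2 * (3 * 2 ^ k - 1))"
      using one_le_power[of "2::nat" k] unfolding power_Suc by linarith
    then show ?case using Suc by (simp only: digsum_Suc_double)
  qed
  then have s: "digsum (m - 1) = Suc r" using m by simp
  have 1: "multiplicity 2 ((n + m - 1) choose (m - 1)) + digsum (n + m - 1) = Suc r + digsum n"
    using multiplicity_binomial_digsum[of "m - 1" n] m1 s by (simp add: add.commute)
  have "m + 2 * i - 1 + (n - i) = n + m + i - 1" using i m1 by simp
  then have 2: "multiplicity 2 ((n + m + i - 1) choose (m + 2 * i - 1)) + digsum (n + m + i - 1)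
      = digsum (m + 2 * i - 1) + digsum (n - i)"
    using multiplicity_binomial_digsum[of "m + 2 * i - 1" "n - i"] by simp
  show ?thesis using 1 2 digsum_inequality[OF assms] by linarith
qed

subsection \<open>Power series with coefficients divisible by powers of four\<close>

text \<open>The series \<open>1 / (1 - c x)\<close>, given by its coefficients so that no inverse
  over the integers is involved.\<close>

definition geom_fps :: "int \<Rightarrow> int fps" where
  "geom_fps c = Abs_fps (\<lambda>n. c ^ n)"

lemma geom_fps_nth [simp]: "fps_nth (geom_fps c) n = c ^ n"
  by (simp add: geom_fps_def)

lemma geom_fps_inverse: "(1 - fps_const c * fps_X) * geom_fps c = 1"
proof (rule fps_ext)
  fix n
  show "fps_nth ((1 - fps_const c * fps_X) * geom_fps c) n = fps_nth 1 n"
    by (cases n) (simp_all add: left_diff_distrib mult.assoc)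
qed

text \<open>Multiplication by \<open>1 / (1 - x)\<close> takes partial sums, so the induction step
  is the hockey-stick identity.\<close>

lemma geom_fps_1_power_nth: "fps_nth (geom_fps 1 ^ Suc p) n = int ((n + p) choose p)"
proof (induction p arbitrary: n)
  case (Suc p)
  have "fps_nth (geom_fps 1 ^ Suc (Suc p)) n
      = fps_nth (geom_fps 1 ^ Suc p * geom_fps 1) n"
    by (simp only: power_Suc2)
  also have "\<dots> = (\<Sum>i = 0..n. fps_nth (geom_fps 1 ^ Suc p) i)"
    by (simp only: fps_mult_nth geom_fps_nth power_one mult_1_right)
  also have "\<dots> = int (\<Sum>i\<le>n. (p + i) choose p)"
    by (simp only: Suc of_nat_sum atMost_atLeast0 add.commute)
  also have "\<dots> = int ((n + Suc p) choose Suc p)"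
    by (simp only: choose_rising_sum(1)) (simp add: add.commute)
  finally show ?case .
qed simp

text \<open>As \<open>z ^ i\<close> starts in degree at least \<open>i\<close>, the range
  \<open>0..n\<close> serves every coefficient up to \<open>n\<close>, and the two sums can be
  swapped.\<close>

lemma fps_mult_compose_nth:
  fixes b g z :: "'a :: idom fps"
  assumes "fps_nth z 0 = 0"
  shows "fps_nth (g * (b oo z)) n = (\<Sum>i = 0..n. fps_nth b i * fps_nth (g * z ^ i) n)"
proof -
  have *: "fps_nth (b oo z) j = (\<Sum>i = 0..n. fps_nth b i * fps_nth (z ^ i) j)" if "j \<le> n" for j
    unfolding fps_compose_nth
    by (rule sum.mono_neutral_left)
      (use that startsby_zero_power_prefix[OF assms] in \<open>auto simp: not_le\<close>)
  have "fps_nth (g * (b oo z)) n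
      = (\<Sum>j = 0..n. fps_nth g j * (\<Sum>i = 0..n. fps_nth b i * fps_nth (z ^ i) (n - j)))"
    unfolding fps_mult_nth by (rule sum.cong) (simp_all add: *)
  also have "\<dots> = (\<Sum>j = 0..n. \<Sum>i = 0..n. fps_nth b i * (fps_nth g j * fps_nth (z ^ i) (n - j)))"
    by (simp add: sum_distrib_left mult_ac)
  also have "\<dots> = (\<Sum>i = 0..n. \<Sum>j = 0..n. fps_nth b i * (fps_nth g j * fps_nth (z ^ i) (n - j)))"
    by (rule sum.swap)
  also have "\<dots> = (\<Sum>i = 0..n. fps_nth b i * fps_nth (g * z ^ i) n)"
    by (simp add: sum_distrib_left fps_mult_nth)
  finally show ?thesis .
qed

lemma fps_mult_nth_cong:
  assumes "\<And>i. i < N \<Longrightarrow> fps_nth f i = fps_nth f' i" "\<And>i. i < N \<Longrightarrow> fps_nth g i = fps_nth g' i" "n < N"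
  shows "fps_nth (f * g) n = fps_nth (f' * g') n"
  unfolding fps_mult_nth by (rule sum.cong) (use assms in auto)

lemma fps_power_nth_cong:
  assumes "\<And>i. i < N \<Longrightarrow> fps_nth f i = fps_nth f' i" "n < N"
  shows "fps_nth (f ^ p) n = fps_nth (f' ^ p) n"
  using assms(2)
proof (induction p arbitrary: n)
  case (Suc p)
  show ?case unfolding power_Suc by (rule fps_mult_nth_cong[where N = N]) (use assms Suc in auto)
qed simp

lemma fps_compose_X2_nth:
  "fps_nth (f oo fps_X ^ 2) n = (if even n then fps_nth f (n div 2) else 0)"
  for f :: "'a :: comm_ring_1 fps"
proof -
  have "fps_nth (f oo fps_X ^ 2) n = (\<Sum>i = 0..n. fps_nth f i * (if n = 2 * i then 1 else 0))"
    by (simp add: fps_compose_nth fps_X_power_nth flip: power_mult)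
  also have "\<dots> = (\<Sum>i \<in> {i. n = 2 * i}. fps_nth f i)"
    by (rule sum.mono_neutral_cong_right) auto
  also have "{i. n = 2 * i} = (if even n then {n div 2} else {})"
    by auto
  finally show ?thesis by auto
qed

section \<open>The ring of series with coefficients divisible by 4 to the digit sum\<close>

text \<open>The indeterminate of these series stands for \<open>z\<close>, not for
  \<open>x\<close>.\<close>

definition digsum_fps :: "int fps set" where
  "digsum_fps = {a. \<forall>i. 4 ^ digsum i dvd fps_nth a i}"

lemma digsum_fpsD: "a \<in> digsum_fps \<Longrightarrow> 4 ^ digsum i dvd fps_nth a i"
  by (simp add: digsum_fps_def)

lemma digsum_fps_1 [simp]: "1 \<in> digsum_fps"
  by (simp add: digsum_fps_def)

lemma digsum_fps_diff: "a \<in> digsum_fps \<Longrightarrow> b \<in> digsum_fps \<Longrightarrow> a - b \<in> digsum_fps"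
  by (simp add: digsum_fps_def)

lemma digsum_fps_add: "a \<in> digsum_fps \<Longrightarrow> b \<in> digsum_fps \<Longrightarrow> a + b \<in> digsum_fps"
  by (simp add: digsum_fps_def)

lemma pow4_digsum_add_dvd:
  fixes u v :: int
  assumes "4 ^ digsum i dvd u" "4 ^ digsum j dvd v"
  shows "4 ^ digsum (i + j) dvd u * v"
proof -
  have "(4::int) ^ digsum (i + j) dvd 4 ^ (digsum i + digsum j)"
    by (rule le_imp_power_dvd) (rule digsum_add_le)
  also have "\<dots> dvd u * v"
    unfolding power_add using assms by (rule mult_dvd_mono)
  finally show ?thesis .
qed

lemma digsum_fps_mult:
  assumes "a \<in> digsum_fps" "b \<in> digsum_fps"
  shows "a * b \<in> digsum_fps"
proof -
  have "4 ^ digsum n dvd fps_nth (a * b) n" for n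
    unfolding fps_mult_nth
  proof (rule dvd_sum)
    fix i assume "i \<in> {0..n}"
    then show "4 ^ digsum n dvd fps_nth a i * fps_nth b (n - i)"
      using pow4_digsum_add_dvd[OF assms[THEN digsum_fpsD], of i "n - i"] by simp
  qed
  then show ?thesis by (simp add: digsum_fps_def)
qed

lemma digsum_fps_power: "a \<in> digsum_fps \<Longrightarrow> a ^ p \<in> digsum_fps"
  by (induction p) (auto intro: digsum_fps_mult)

lemma geom_fps_in_digsum_fps: "geom_fps (- 4) \<in> digsum_fps"
proof -
  have "(4::int) ^ digsum i dvd (- 4) ^ i" for i
    using le_imp_power_dvd[OF digsum_le_self[of i], of "4::int"]
    by (cases "even i") simp_all
  then show ?thesis by (simp add: digsum_fps_def)
qed

text \<open>The substitution \<open>z \<mapsto> z^2 / (1 + 4 z)\<close> sends \<open>z^i\<close> to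
  \<open>z^(2 i)\<close> times a member of the ring, and doubling an index keeps its digit
  sum.\<close>

lemma digsum_fps_compose:
  assumes "a \<in> digsum_fps"
  shows "a oo (fps_X ^ 2 * geom_fps (- 4)) \<in> digsum_fps"
proof -
  have "4 ^ digsum n dvd fps_nth (a oo (fps_X ^ 2 * geom_fps (- 4))) n" for n
    unfolding fps_compose_nth
  proof (rule dvd_sum)
    fix i
    show "4 ^ digsum n dvd fps_nth a i * fps_nth ((fps_X ^ 2 * geom_fps (- 4)) ^ i) n"
    proof (cases "2 * i \<le> n")
      case True
      have "4 ^ digsum (2 * i) dvd fps_nth a i"
        using digsum_fpsD[OF assms] by simp
      moreover have "4 ^ digsum (n - 2 * i) dvd fps_nth (geom_fps (- 4) ^ i) (n - 2 * i)"
        by (intro digsum_fpsD digsum_fps_power geom_fps_in_digsum_fps)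
      ultimately have "4 ^ digsum (2 * i + (n - 2 * i))
          dvd fps_nth a i * fps_nth (geom_fps (- 4) ^ i) (n - 2 * i)"
        by (rule pow4_digsum_add_dvd)
      with True show ?thesis
        by (simp add: power_mult_distrib fps_X_power_mult_nth flip: power_mult)
    next
      case False
      then show ?thesis
        by (simp add: power_mult_distrib fps_X_power_mult_nth flip: power_mult)
    qed
  qed
  then show ?thesis by (simp add: digsum_fps_def)
qed

text \<open>Off-diagonal products in \<open>c ^ 2\<close> occur in pairs, which gives the factor 2.
  The diagonal product at \<open>n = 2 * i\<close> is a square with divisibility to spare for
  \<open>i > 0\<close>, and it vanishes for \<open>i = 0\<close>.\<close>

lemma digsum_fps_square:
  assumes c: "c \<in> digsum_fps" "fps_nth c 0 = 0"
  obtains d where "d \<in> digsum_fps" "fps_nth d 0 = 0" "c ^ 2 = 2 * d"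
proof -
  have *: "2 * 4 ^ digsum n dvd fps_nth (c ^ 2) n" for n
  proof -
    let ?f = "\<lambda>i. fps_nth c i * fps_nth c (n - i)"
    have f: "4 ^ digsum n dvd ?f i" if "i \<le> n" for i
      using pow4_digsum_add_dvd[OF c(1)[THEN digsum_fpsD] c(1)[THEN digsum_fpsD], of i "n - i"] that
      by simp
    have L: "4 ^ digsum n dvd sum ?f {i. 2 * i < n}"
      by (rule dvd_sum) (use f in auto)
    have M: "2 * 4 ^ digsum n dvd sum ?f {i. 2 * i = n}"
    proof (rule dvd_sum)
      fix i assume "i \<in> {i. 2 * i = n}"
      then have n: "n = 2 * i" by simp
      show "2 * 4 ^ digsum n dvd ?f i"
      proof (cases "i = 0")
        case False
        then have "2 dvd (4::int) ^ digsum i" using digsum_pos[of i] by (simp add: dvd_power_iff)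
        also have "\<dots> dvd fps_nth c i" using c(1) by (rule digsum_fpsD)
        finally have "2 * 4 ^ digsum i dvd fps_nth c i * fps_nth c i"
          by (rule mult_dvd_mono) (rule digsum_fpsD[OF c(1)])
        then show ?thesis by (simp add: n)
      qed (simp add: n c)
    qed
    have eq: "{0..n} = {i. 2 * i < n} \<union> {i. 2 * i = n} \<union> {i. i \<le> n \<and> n < 2 * i}" by auto
    have fin: "finite {i. 2 * i < n}" "finite {i. 2 * i = n}" "finite {i. i \<le> n \<and> n < 2 * i}"
      by (rule finite_subset[of _ "{0..n}"]; auto)+
    have "fps_nth (c ^ 2) n = sum ?f {0..n}"
      by (simp add: power2_eq_square fps_mult_nth)
    also have "\<dots> = sum ?f {i. 2 * i < n} + sum ?f {i. 2 * i = n} + sum ?f {i. i \<le> n \<and> n < 2 * i}"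
      unfolding eq using fin by (subst sum.union_disjoint; (subst sum.union_disjoint)?) auto
    also have "sum ?f {i. i \<le> n \<and> n < 2 * i} = sum ?f {i. 2 * i < n}"
      by (rule sum.reindex_bij_witness[of _ "\<lambda>i. n - i" "\<lambda>i. n - i"]) (auto simp: mult.commute)
    finally have "fps_nth (c ^ 2) n = 2 * sum ?f {i. 2 * i < n} + sum ?f {i. 2 * i = n}" by simp
    then show ?thesis using L M by (simp add: dvd_add)
  qed
  define d where "d = Abs_fps (\<lambda>n. fps_nth (c ^ 2) n div 2)"
  have d: "2 * fps_nth d n = fps_nth (c ^ 2) n" for n
    using dvd_mult_left[OF *[of n]] by (simp add: d_def)
  show ?thesis
  proof
    have "2 * 4 ^ digsum n dvd 2 * fps_nth d n" for n
      unfolding d by (rule *)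
    then show "d \<in> digsum_fps" by (simp add: digsum_fps_def)
    show "c ^ 2 = 2 * d"
      by (rule fps_ext) (simp add: numeral_fps_const d)
    show "fps_nth d 0 = 0" using d[of 0] c by (simp add: fps_power_zeroth)
  qed
qed

text \<open>Each squaring of \<open>1 + 2 ^ e * c\<close> gains one factor 2; for
  \<open>e = 0\<close> this relies on \<open>c ^ 2 = 2 * d\<close>.\<close>

lemma digsum_fps_power_pow2:
  assumes "a \<in> digsum_fps" "fps_nth a 0 = 1" "i > 0"
  shows "2 ^ e * 4 ^ digsum i dvd fps_nth (a ^ (2 ^ e)) i"
proof -
  have "\<exists>c. c \<in> digsum_fps \<and> fps_nth c 0 = 0 \<and> a ^ (2 ^ e) = 1 + 2 ^ e * c"
  proof (induction e)
    case 0
    show ?case using assms by (intro exI[of _ "a - 1"]) (auto intro: digsum_fps_diff)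
  next
    case (Suc e)
    then obtain c where c: "c \<in> digsum_fps" "fps_nth c 0 = 0" "a ^ (2 ^ e) = 1 + 2 ^ e * c" by blast
    obtain d where d: "d \<in> digsum_fps" "fps_nth d 0 = 0" "c ^ 2 = 2 * d"
      using digsum_fps_square c by blast
    have "a ^ (2 ^ Suc e) = (a ^ (2 ^ e)) ^ 2"
      by (simp add: mult.commute flip: power_mult)
    also have "\<dots> = 1 + 2 ^ Suc e * c + 2 ^ e * 2 ^ e * c ^ 2"
      unfolding c(3) by (simp add: power2_eq_square algebra_simps)
    also have "\<dots> = 1 + 2 ^ Suc e * (c + 2 ^ e * d)"
      unfolding d(3) by (simp add: algebra_simps)
    finally have "a ^ (2 ^ Suc e) = 1 + 2 ^ Suc e * (c + 2 ^ e * d)" .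
    moreover have "2 ^ e * d \<in> digsum_fps"
      using d by (simp add: digsum_fps_def numeral_fps_const fps_const_power dvd_mult)
    ultimately show ?case using c d
      by (intro exI[of _ "c + 2 ^ e * d"]) (auto intro: digsum_fps_add)
  qed
  then obtain c where c: "c \<in> digsum_fps" "a ^ (2 ^ e) = 1 + 2 ^ e * c" by blast
  have "fps_nth (a ^ (2 ^ e)) i = 2 ^ e * fps_nth c i"
    unfolding c(2) using assms by (simp add: numeral_fps_const fps_const_power)
  then show ?thesis using digsum_fpsD[OF c(1), of i] by (simp add: mult_dvd_mono)
qed

subsection \<open>Expansion of the powers of the Thue--Morse series\<close>

text \<open>Splitting off the factor \<open>j = 0\<close> gives the identity for partial products,
  whose coefficients are eventually those of the limit.\<close>

lemma thue_morse_fps_functional_eq: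
  "thue_morse_fps = (1 - fps_X) * (thue_morse_fps oo fps_X ^ 2)"
proof (rule fps_ext)
  fix n
  define P :: "nat \<Rightarrow> int fps" where "P N = (\<Prod>j<N. 1 - fps_X ^ (2 ^ j))" for N
  have P_Suc: "P (Suc N) = (1 - fps_X) * (P N oo fps_X ^ 2)" for N
    unfolding P_def prod.lessThan_Suc_shift
    by (simp add: fps_compose_prod_distrib fps_compose_sub_distrib fps_compose_power[symmetric]
        flip: power_mult)
  have "P \<longlonglongrightarrow> thue_morse_fps"
    unfolding P_def by (rule has_prod_imp_tendsto'[OF thue_morse_has_prod])
  then have "\<forall>\<^sub>F N in sequentially. fps_nth (P N) k = fps_nth thue_morse_fps k" for k
    by (simp add: tendsto_fps_iff)
  then have "\<forall>\<^sub>F N in sequentially. \<forall>k\<in>{..n}. fps_nth (P N) k = fps_nth thue_morse_fps k"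
    by (intro eventually_ball_finite) auto
  then obtain N where N: "fps_nth (P M) k = fps_nth thue_morse_fps k" if "k \<le> n" "M \<ge> N" for k M
    unfolding eventually_sequentially by blast
  have "fps_nth thue_morse_fps n = fps_nth (P (Suc N)) n"
    using N[of n "Suc N"] by simp
  also have "\<dots> = fps_nth ((1 - fps_X) * (thue_morse_fps oo fps_X ^ 2)) n"
    unfolding P_Suc
    by (rule fps_mult_nth_cong[where N = "Suc n"]) (use N[of _ N] in \<open>auto simp: fps_compose_X2_nth\<close>)
  finally show "fps_nth thue_morse_fps n = fps_nth ((1 - fps_X) * (thue_morse_fps oo fps_X ^ 2)) n" .
qed

section \<open>The Koebe function \<open>z = x / (1 - x)^2\<close> under
  \<open>x \<mapsto> x^2\<close>\<close>

definition koebe_fps :: "int fps" where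
  "koebe_fps = fps_X * geom_fps 1 ^ 2"

lemma koebe_fps_nth_0 [simp]: "fps_nth koebe_fps 0 = 0"
  by (simp add: koebe_fps_def)

text \<open>This is \<open>1 + 4 z = ((1 + x) / (1 - x))^2\<close> with denominators
  cleared.\<close>

lemma geom_fps_compose_koebe:
  "(1 + fps_X) ^ 2 * (geom_fps (- 4) oo koebe_fps) = (1 - fps_X) ^ 2"
proof -
  let ?g = "geom_fps 1" and ?w = "geom_fps (- 4) oo koebe_fps"
  have g: "(1 - fps_X) * ?g = 1" using geom_fps_inverse[of 1] by simp
  have "((1 - fps_const (- 4) * fps_X) * geom_fps (- 4)) oo koebe_fps = 1 oo koebe_fps"
    by (simp only: geom_fps_inverse)
  then have w: "(1 + 4 * koebe_fps) * ?w = 1"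
    by (simp add: fps_compose_mult_distrib fps_compose_sub_distrib fps_compose_add_distrib numeral_fps_const
        flip: fps_const_neg)
  have "(1 - fps_X) ^ 2 * (1 + 4 * koebe_fps) = (1 - fps_X) ^ 2 + 4 * fps_X * ((1 - fps_X) * ?g) ^ 2"
    by (simp add: koebe_fps_def distrib_left power_mult_distrib mult_ac)
  also have "\<dots> = (1 + fps_X) ^ 2"
    unfolding g by (simp add: power2_eq_square algebra_simps)
  finally have "(1 + fps_X) ^ 2 * ?w = (1 - fps_X) ^ 2 * ((1 + 4 * koebe_fps) * ?w)"
    by (simp add: mult.assoc)
  then show ?thesis using w by simp
qed

lemma koebe_fps_compose_X2:
  "koebe_fps oo fps_X ^ 2 = (fps_X ^ 2 * geom_fps (- 4)) oo koebe_fps"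
proof -
  let ?g = "geom_fps 1" and ?w = "geom_fps (- 4) oo koebe_fps"
  have g: "(1 - fps_X) * ?g = 1" using geom_fps_inverse[of 1] by simp
  then have "((1 - fps_X) * ?g) oo fps_X ^ 2 = 1 oo fps_X ^ 2" by simp
  then have g2: "(1 - fps_X ^ 2) * (?g oo fps_X ^ 2) = 1"
    by (simp add: fps_compose_mult_distrib fps_compose_sub_distrib)
  have fac: "(1 - fps_X ^ 2 :: int fps) = (1 - fps_X) * (1 + fps_X)"
    by (simp add: power2_eq_square algebra_simps)
  have "(1 - fps_X ^ 2) ^ 2 * (koebe_fps oo fps_X ^ 2)
      = fps_X ^ 2 * ((1 - fps_X ^ 2) * (?g oo fps_X ^ 2)) ^ 2"
    by (simp add: koebe_fps_def fps_compose_mult_distrib fps_compose_power[symmetric]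
        power_mult_distrib mult_ac)
  also have "\<dots> = fps_X ^ 2" unfolding g2 by simp
  \<comment> \<open>The factor 1 is inserted to turn \<open>x^2\<close> into
    \<open>z^2 (1 - x)^4\<close>.\<close>
  also have "\<dots> = fps_X ^ 2 * ((1 - fps_X) * ?g) ^ 4"
    unfolding g by simp
  also have "\<dots> = (fps_X * ?g ^ 2) ^ 2 * ((1 - fps_X) ^ 2 * (1 - fps_X) ^ 2)"
    by (simp add: power_mult_distrib mult_ac flip: power_add power_mult)
  also have "\<dots> = koebe_fps ^ 2 * ((1 - fps_X) ^ 2 * ((1 + fps_X) ^ 2 * ?w))"
    by (subst geom_fps_compose_koebe) (simp only: koebe_fps_def)
  also have "\<dots> = (1 - fps_X ^ 2) ^ 2 * ((fps_X ^ 2 * geom_fps (- 4)) oo koebe_fps)"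
    unfolding fac
    by (simp add: fps_compose_mult_distrib fps_compose_power[symmetric] power_mult_distrib mult_ac)
  finally have "(1 - fps_X ^ 2) ^ 2 * (koebe_fps oo fps_X ^ 2)
      = (1 - fps_X ^ 2) ^ 2 * ((fps_X ^ 2 * geom_fps (- 4)) oo koebe_fps)" .
  moreover have "fps_nth (1 - fps_X ^ 2 :: int fps) 0 = 1" by simp
  then have "(1 - fps_X ^ 2 :: int fps) \<noteq> 0" by (metis fps_zero_nth zero_neq_one)
  then have "(1 - fps_X ^ 2 :: int fps) ^ 2 \<noteq> 0" by simp
  ultimately show ?thesis by simp
qed

text \<open>By the functional equation, both sides equal \<open>(1 - x)^4 T(x^2)^2\<close>.\<close>

lemma thue_morse_normalized_square:
  "((1 - fps_X) * thue_morse_fps) ^ 2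
    = (geom_fps (- 4) oo koebe_fps) * (((1 - fps_X) * thue_morse_fps) ^ 2 oo fps_X ^ 2)"
proof -
  let ?T2 = "thue_morse_fps oo fps_X ^ 2" and ?w = "geom_fps (- 4) oo koebe_fps"
  have fac: "(1 - fps_X ^ 2 :: int fps) = (1 - fps_X) * (1 + fps_X)"
    by (simp add: power2_eq_square algebra_simps)
  have "?w * (((1 - fps_X) * thue_morse_fps) ^ 2 oo fps_X ^ 2)
      = ?w * ((1 - fps_X ^ 2) * ?T2) ^ 2"
    by (simp add: fps_compose_power[symmetric] fps_compose_mult_distrib fps_compose_sub_distrib)
  also have "\<dots> = ((1 + fps_X) ^ 2 * ?w) * ((1 - fps_X) * ?T2) ^ 2"
    unfolding fac by (simp add: power_mult_distrib mult_ac)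
  also have "\<dots> = ((1 - fps_X) * ((1 - fps_X) * ?T2)) ^ 2"
    unfolding geom_fps_compose_koebe by (simp only: power_mult_distrib mult_ac)
  also have "(1 - fps_X) * ?T2 = thue_morse_fps"
    by (rule thue_morse_fps_functional_eq [symmetric])
  finally show ?thesis by simp
qed

text \<open>Finite precision replaces a limit in \<open>z\<close>. Coefficient \<open>n\<close> of
  \<open>f(x^2)\<close> reads \<open>f\<close> at \<open>n / 2\<close>, so each use of the
  functional equation doubles the range of agreement.\<close>

lemma thue_morse_normalized_square_expansion:
  "\<exists>a \<in> digsum_fps. fps_nth a 0 = 1 \<and>
    (\<forall>n < 2 ^ k. fps_nth (((1 - fps_X) * thue_morse_fps) ^ 2) n = fps_nth (a oo koebe_fps) n)"
proof (induction k)
  case 0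
  have "fps_nth thue_morse_fps 0 = 1"
  proof -
    have "fps_nth (\<Prod>j<N. 1 - fps_X ^ (2 ^ j) :: int fps) 0 = 1" for N
      by (induction N) simp_all
    moreover have "\<forall>\<^sub>F N in sequentially.
        fps_nth (\<Prod>j<N. 1 - fps_X ^ (2 ^ j)) 0 = fps_nth thue_morse_fps 0"
      using has_prod_imp_tendsto'[OF thue_morse_has_prod] by (simp add: tendsto_fps_iff)
    ultimately show ?thesis by simp
  qed
  then show ?case by (intro bexI[of _ 1]) (simp_all add: fps_power_zeroth)
next
  case (Suc k)
  let ?E = "((1 - fps_X) * thue_morse_fps) ^ 2" and ?q = "fps_X ^ 2 * geom_fps (- 4)"
  obtain a where a: "a \<in> digsum_fps" "fps_nth a 0 = 1"
    "\<And>n. n < 2 ^ k \<Longrightarrow> fps_nth ?E n = fps_nth (a oo koebe_fps) n"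
    using Suc.IH by blast
  \<comment> \<open>The right-hand side of the functional equation, rewritten in the variable
    \<open>z\<close>.\<close>
  define a' where "a' = geom_fps (- 4) * (a oo ?q)"
  have "a' oo koebe_fps = (geom_fps (- 4) oo koebe_fps) * (a oo (?q oo koebe_fps))"
    unfolding a'_def by (simp add: fps_compose_mult_distrib) (simp add: fps_compose_assoc flip: fps_compose_mult_distrib)
  also have "a oo (?q oo koebe_fps) = (a oo koebe_fps) oo fps_X ^ 2"
    unfolding koebe_fps_compose_X2[symmetric] by (rule fps_compose_assoc) simp_all
  finally have a': "a' oo koebe_fps = (geom_fps (- 4) oo koebe_fps) * ((a oo koebe_fps) oo fps_X ^ 2)" .
  have "fps_nth ?E n = fps_nth (a' oo koebe_fps) n" if "n < 2 ^ Suc k" for n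
  proof -
    have "fps_nth ?E n = fps_nth ((geom_fps (- 4) oo koebe_fps) * (?E oo fps_X ^ 2)) n"
      by (rule arg_cong[OF thue_morse_normalized_square])
    also have "\<dots> = fps_nth (a' oo koebe_fps) n"
      unfolding a'
      by (rule fps_mult_nth_cong[where N = "2 ^ Suc k"])
        (use that a(3) in \<open>auto simp: fps_compose_X2_nth\<close>)
    finally show ?thesis .
  qed
  moreover have "a' \<in> digsum_fps"
    unfolding a'_def using a by (intro digsum_fps_mult geom_fps_in_digsum_fps digsum_fps_compose)
  moreover have "fps_nth a' 0 = 1" using a by (simp add: a'_def)
  ultimately show ?case by blast
qed

text \<open>The sequence \<open>b\<close> may depend on \<open>n\<close>, because precision
  \<open>2 ^ n > n\<close> is enough for one coefficient.\<close>

lemma thue_morse_coeff_expansion: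
  assumes "r \<ge> 1" "m = 3 * 2 ^ r"
  obtains b where "b 0 = 1" "\<And>i. i > 0 \<Longrightarrow> 2 ^ (r - 1) * 4 ^ digsum i dvd b i"
    "thue_morse_coeff m n = (\<Sum>i = 0..n. b i * int ((n + m + i - 1) choose (m + 2 * i - 1)))"
proof -
  let ?E = "((1 - fps_X) * thue_morse_fps) ^ 2" and ?g = "geom_fps 1"
  have m: "m > 0" using assms by simp
  have m2: "m = 2 * (3 * 2 ^ (r - 1))" using assms by (cases r) auto
  obtain a where a: "a \<in> digsum_fps" "fps_nth a 0 = 1"
    "\<And>j. j < 2 ^ n \<Longrightarrow> fps_nth ?E j = fps_nth (a oo koebe_fps) j"
    using thue_morse_normalized_square_expansion[of n] by blast
  \<comment> \<open>The exponent is \<open>m / 2\<close>; its power of two supplies the factor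
    \<open>2 ^ (r - 1)\<close>, while the cube merely stays in the ring.\<close>
  define b where "b = (a ^ 3) ^ (2 ^ (r - 1))"
  have g: "(1 - fps_X) * ?g = 1" using geom_fps_inverse[of 1] by simp
  have "?g ^ m * ?E ^ (3 * 2 ^ (r - 1)) = ((1 - fps_X) * ?g) ^ m * thue_morse_fps ^ m"
    by (simp add: m2 power_mult_distrib mult_ac flip: power_mult)
  then have "thue_morse_fps ^ m = ?g ^ m * ?E ^ (3 * 2 ^ (r - 1))"
    unfolding g by simp
  then have "thue_morse_coeff m n = fps_nth (?g ^ m * ?E ^ (3 * 2 ^ (r - 1))) n"
    by (simp add: thue_morse_coeff_def)
  also have "\<dots> = fps_nth (?g ^ m * (a oo koebe_fps) ^ (3 * 2 ^ (r - 1))) n"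
    by (rule fps_mult_nth_cong[where N = "2 ^ n"], rule refl, rule fps_power_nth_cong[where N = "2 ^ n"])
      (use a(3) in auto)
  also have "(a oo koebe_fps) ^ (3 * 2 ^ (r - 1)) = b oo koebe_fps"
    by (simp add: b_def fps_compose_power flip: power_mult)
  also have "fps_nth (?g ^ m * (b oo koebe_fps)) n
      = (\<Sum>i = 0..n. fps_nth b i * fps_nth (?g ^ m * koebe_fps ^ i) n)"
    by (rule fps_mult_compose_nth) simp
  also have "\<dots> = (\<Sum>i = 0..n. fps_nth b i * int ((n + m + i - 1) choose (m + 2 * i - 1)))"
  proof (rule sum.cong)
    fix i assume i: "i \<in> {0..n}"
    have "?g ^ m * koebe_fps ^ i = fps_X ^ i * ?g ^ Suc (m + 2 * i - 1)"
      using m by (simp add: koebe_fps_def power_mult_distrib power_add mult_ac flip: power_mult)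
    then have "fps_nth (?g ^ m * koebe_fps ^ i) n = fps_nth (?g ^ Suc (m + 2 * i - 1)) (n - i)"
      using i by (simp only: fps_X_power_mult_nth) simp
    also have "\<dots> = int ((n - i + (m + 2 * i - 1)) choose (m + 2 * i - 1))"
      by (rule geom_fps_1_power_nth)
    also have "n - i + (m + 2 * i - 1) = n + m + i - 1" using i m by simp
    finally show "fps_nth b i * fps_nth (?g ^ m * koebe_fps ^ i) n
        = fps_nth b i * int ((n + m + i - 1) choose (m + 2 * i - 1))" by simp
  qed simp
  finally have "thue_morse_coeff m n
    = (\<Sum>i = 0..n. fps_nth b i * int ((n + m + i - 1) choose (m + 2 * i - 1)))" .
  moreover have "2 ^ (r - 1) * 4 ^ digsum i dvd fps_nth b i" if "i > 0" for i
    unfolding b_def using a that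
    by (intro digsum_fps_power_pow2 digsum_fps_power) (simp_all add: fps_power_zeroth)
  moreover have "fps_nth b 0 = 1"
    using a by (simp add: b_def fps_power_zeroth)
  ultimately show ?thesis using that by blast
qed

section \<open>Comparison of the 2-adic valuations of the terms\<close>

theorem theorem1p2:
  fixes r m n :: nat
  assumes "r \<ge> 2"
    and "m = 3 * 2 ^ r"
  shows "nu2 (thue_morse_coeff m n) = nu2 (int ((n + m - 1) choose (m - 1)))"
proof -
  define C where "C i = (n + m + i - 1) choose (m + 2 * i - 1)" for i
  define v where "v = multiplicity 2 (C 0)"
  have m: "m \<ge> 1" using assms by simp
  have C0: "C 0 \<noteq> 0" using m by (simp add: C_def)
  obtain b where b: "b 0 = 1" "\<And>i. i > 0 \<Longrightarrow> 2 ^ (r - 1) * 4 ^ digsum i dvd b i"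
    "thue_morse_coeff m n = (\<Sum>i = 0..n. b i * int (C i))"
    using thue_morse_coeff_expansion[of r m n] assms unfolding C_def by auto
  \<comment> \<open>The margin 2 in \<open>multiplicity_binomial_le\<close> pays for having
    \<open>r - 1\<close> instead of \<open>r\<close> and for the strictness.\<close>
  have summand: "2 ^ Suc v dvd b i * int (C i)" if i: "i \<in> {1..n}" for i
  proof -
    have "v + 2 \<le> multiplicity 2 (C i) + r + 2 * digsum i"
      using multiplicity_binomial_le[OF assms, of i n] i by (simp add: C_def v_def)
    then have "(2::int) ^ Suc v dvd 2 ^ (r - 1 + 2 * digsum i + multiplicity 2 (C i))"
      using assms by (intro le_imp_power_dvd) simp
    also have "\<dots> = 2 ^ (r - 1) * 4 ^ digsum i * int (2 ^ multiplicity 2 (C i))"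
      by (simp add: power_add power_mult)
    also have "\<dots> dvd b i * int (C i)"
      using i multiplicity_dvd[of 2 "C i"] by (intro mult_dvd_mono b) (simp_all only: of_nat_dvd_iff, simp)
    finally show ?thesis .
  qed
  have "thue_morse_coeff m n = int (C 0) + (\<Sum>i = 1..n. b i * int (C i))"
    unfolding b(3) by (simp add: sum.atLeast_Suc_atMost b(1))
  moreover have "2 ^ Suc v dvd (\<Sum>i = 1..n. b i * int (C i))"
    by (rule dvd_sum) (rule summand)
  ultimately obtain D where D: "thue_morse_coeff m n = int (C 0) + 2 ^ Suc v * D"
    by (auto elim!: dvdE)
  \<comment> \<open>A congruence modulo \<open>2 ^ Suc v\<close> fixes a valuation equal to
    \<open>v\<close>.\<close>
  have dvd_iff: "2 ^ k dvd thue_morse_coeff m n \<longleftrightarrow> 2 ^ k dvd int (C 0)" if "k \<le> Suc v" for k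
  proof -
    have "(2::int) ^ k dvd 2 ^ Suc v * D"
      using le_imp_power_dvd[OF that] by (rule dvd_mult2)
    then show ?thesis unfolding D by (rule dvd_add_left_iff)
  qed
  have v: "multiplicity 2 (int (C 0)) = v"
  proof (rule multiplicity_eqI)
    have pow: "2 ^ k dvd int (C 0) \<longleftrightarrow> 2 ^ k dvd C 0" for k
      using of_nat_dvd_iff[of "2 ^ k" "C 0", where 'a = int] by simp
    show "2 ^ v dvd int (C 0)"
      unfolding pow v_def by (rule multiplicity_dvd)
    show "\<not> 2 ^ Suc v dvd int (C 0)"
      unfolding pow using C0 by (subst power_dvd_iff_le_multiplicity) (simp_all add: v_def)
  qed
  have "\<not> 2 ^ Suc v dvd int (C 0)"
    using C0 v power_dvd_iff_le_multiplicity[of "int (C 0)" 2 "Suc v"] by simp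
  then have not_dvd: "\<not> 2 ^ Suc v dvd thue_morse_coeff m n" using dvd_iff[OF order_refl] by blast
  have "2 ^ v dvd thue_morse_coeff m n"
    using dvd_iff[of v] multiplicity_dvd[of 2 "int (C 0)"] v by simp
  then have "multiplicity 2 (thue_morse_coeff m n) = v"
    using not_dvd by (rule multiplicity_eqI)
  \<comment> \<open>This rules out the infinite value of \<open>nu2\<close>.\<close>
  moreover have "thue_morse_coeff m n \<noteq> 0" using not_dvd by auto
  ultimately show ?thesis using v C0 by (simp add: nu2_def C_def)
qed

end
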